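(* Let $H$ be a decomposition monoid. Then $\mathcal{R}(H)=\mathcal{S}(H)$, i.e. an element of $H$ is radical if and only if it is square-free.
   Context: Monoid means commutative cancellative monoid (written multiplicatively). $H^{\times}$ denotes the group of invertible elements of $H$. $H$ is a decomposition monoid if for all $a,b,c\in H$ with $a\mid bc$ there exist $a_1,a_2\in H$ with $a=a_1a_2$, $a_1\mid b$ and $a_2\mid c$. An element $a\in H$ is radical if for all $b\in H$ and $n\geq 1$, $a\mid b^n$ implies $a\mid b$ (equivalently, the principal ideal $aH$ is radical); $\mathcal{R}(H)$ is the set of radical elements. An element $a\in H$ is square-free if it cannot be written as $a=b^2c$ with $b,c\in H$ and $b\notin H^{\times}$; $\mathcal{S}(H)$ is the set of square-free elements. *)

theory Defs
  imports "HOL-Algebra.Divisibility"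
begin

locale decomposition_monoid = comm_monoid_cancel H for H (structure) +
  assumes decomposition:
    "\<lbrakk>a \<in> carrier H; b \<in> carrier H; c \<in> carrier H; a divides (b \<otimes> c)\<rbrakk>
      \<Longrightarrow> \<exists>a1\<in>carrier H. \<exists>a2\<in>carrier H. a = a1 \<otimes> a2 \<and> a1 divides b \<and> a2 divides c"

definition radical_elements :: "('a, 'm) monoid_scheme \<Rightarrow> 'a set"
  where "radical_elements H =
    {a \<in> carrier H. \<forall>b\<in>carrier H. \<forall>n::nat. n \<ge> 1 \<longrightarrow>
       a divides\<^bsub>H\<^esub> (b [^]\<^bsub>H\<^esub> n) \<longrightarrow> a divides\<^bsub>H\<^esub> b}"

definition square_free_elements :: "('a, 'm) monoid_scheme \<Rightarrow> 'a set"
  where "square_free_elements H =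
    {a \<in> carrier H. \<not> (\<exists>b\<in>carrier H. \<exists>c\<in>carrier H.
       b \<notin> Units H \<and> a = (b [^]\<^bsub>H\<^esub> (2::nat)) \<otimes>\<^bsub>H\<^esub> c)}"

end

theory Submission
  imports Defs
begin

text \<open>
  If \<open>a = b\<^sup>2c\<close> is radical, then \<open>a\<close> divides \<open>(bc)\<^sup>2\<close>, hence \<open>bc\<close>, and cancelling \<open>bc\<close> makes \<open>b\<close>
  invertible. Conversely, let \<open>a\<close> be square-free and \<open>a\<close> divide \<open>b\<^sup>n\<^sup>+\<^sup>1\<close>. Split \<open>a = a\<^sub>1a\<^sub>2\<close> with
  \<open>a\<^sub>1\<close> dividing \<open>b\<close> and \<open>a\<^sub>2\<close> dividing \<open>b\<^sup>n\<close>; by induction \<open>a\<^sub>2\<close> divides \<open>b = a\<^sub>1u\<close>. Split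
  \<open>a\<^sub>2 = xy\<close> with \<open>x\<close> dividing \<open>a\<^sub>1\<close> and \<open>y\<close> dividing \<open>u\<close>. Then \<open>x\<^sup>2\<close> divides \<open>a\<close>, so \<open>x\<close> is
  invertible, \<open>a\<^sub>2\<close> divides \<open>u\<close>, and \<open>a\<close> divides \<open>b\<close>.
\<close>

context comm_monoid_cancel
begin

text \<open>Lets the induction on the exponent pass from \<open>a\<close> to its factor
  \<open>a2\<close>.\<close>

lemma square_free_divisor:
  assumes a: "a \<in> square_free_elements G" and d: "d \<in> carrier G" "d divides a"
  shows "d \<in> square_free_elements G"
proof -
  obtain e where e: "e \<in> carrier G" "a = d \<otimes> e"
    using d(2) by (rule dividesE)
  have "b \<in> Units G" if b: "b \<in> carrier G" and c: "c \<in> carrier G"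
    and dbc: "d = b [^] (2::nat) \<otimes> c" for b c
  proof -
    have "a = b [^] (2::nat) \<otimes> (c \<otimes> e)"
      using e b c dbc by (simp add: m_assoc)
    then show ?thesis
      using a b c e(1) unfolding square_free_elements_def by blast
  qed
  then show ?thesis
    using d(1) unfolding square_free_elements_def by blast
qed

lemma square_divides_square_free:
  assumes "a \<in> square_free_elements G" "x \<in> carrier G" "x \<otimes> x divides a"
  shows "x \<in> Units G"
proof -
  obtain c where c: "c \<in> carrier G" "a = x \<otimes> x \<otimes> c"
    using assms(3) by (rule dividesE)
  then have "a = x [^] (2::nat) \<otimes> c"
    using assms(2) by (simp add: numeral_2_eq_2)
  with assms(1,2) c(1) show ?thesis
    unfolding square_free_elements_def by blast
qed

lemma radical_imp_square_free:
  assumes "a \<in> radical_elements G"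
  shows "a \<in> square_free_elements G"
proof -
  have a: "a \<in> carrier G"
    using assms unfolding radical_elements_def by blast
  have "b \<in> Units G" if b: "b \<in> carrier G" and c: "c \<in> carrier G"
    and abc: "a = b [^] (2::nat) \<otimes> c" for b c
  proof -
    have "(b \<otimes> c) [^] (2::nat) = a \<otimes> c"
      using b c unfolding abc by (simp add: numeral_2_eq_2 m_ac)
    then have "a divides (b \<otimes> c) [^] (2::nat)"
      using c by (rule dividesI[rotated])
    then have "a divides b \<otimes> c"
      using assms m_closed[OF b c] one_le_numeral unfolding radical_elements_def by blast
    then obtain d where d: "d \<in> carrier G" "b \<otimes> c = a \<otimes> d"
      by (rule dividesE)
    \<comment> \<open>One of the two factors \<open>b\<close> in \<open>a\<close> goes with
      \<open>c\<close>, the other with \<open>d\<close>, so that \<open>b \<otimes> c\<close> can be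
      cancelled.\<close>
    have "a \<otimes> d = (b \<otimes> c) \<otimes> (b \<otimes> d)"
      using d(1) b c unfolding abc by (simp add: numeral_2_eq_2 m_ac)
    then have "(b \<otimes> c) \<otimes> \<one> = (b \<otimes> c) \<otimes> (b \<otimes> d)"
      unfolding d(2)[symmetric] r_one[OF m_closed[OF b c]] .
    then have "\<one> = b \<otimes> d"
      by (rule l_cancel) (simp_all add: b c d(1))
    then have "b \<otimes> d = \<one>" "d \<otimes> b = \<one>"
      using m_comm[OF b d(1)] by simp_all
    then show ?thesis
      using b d(1) unfolding Units_def by blast
  qed
  with a show ?thesis
    unfolding square_free_elements_def by blast
qed

end

context decomposition_monoid
begin

text \<open>Any factor shared by \<open>a1\<close> and \<open>a2\<close> occurs squared in the
  product, so it is a unit.\<close>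

lemma square_free_mult_divides:
  assumes a: "a1 \<otimes> a2 \<in> square_free_elements H"
    and a1: "a1 \<in> carrier H" and a2: "a2 \<in> carrier H" and b: "b \<in> carrier H"
    and a1b: "a1 divides b" and a2b: "a2 divides b"
  shows "a1 \<otimes> a2 divides b"
proof -
  obtain u where u: "u \<in> carrier H" "b = a1 \<otimes> u"
    using a1b by (rule dividesE)
  obtain x y where x: "x \<in> carrier H" "x divides a1"
    and y: "y \<in> carrier H" "y divides u" and a2xy: "a2 = x \<otimes> y"
    using decomposition[OF a2 a1 u(1)] a2b u(2) by blast
  obtain z where z: "z \<in> carrier H" "a1 = x \<otimes> z"
    using x(2) by (rule dividesE)
  have "a1 \<otimes> a2 = x \<otimes> x \<otimes> (z \<otimes> y)"
    using x(1) y(1) z a2xy by (simp add: m_ac)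
  then have "x \<otimes> x divides a1 \<otimes> a2"
    using y(1) z(1) by (intro dividesI[of "z \<otimes> y"]) auto
  then have unit: "x \<in> Units H"
    using a x(1) by (intro square_divides_square_free)
  obtain w where w: "w \<in> carrier H" "u = y \<otimes> w"
    using y(2) by (rule dividesE)
  \<comment> \<open>As \<open>x\<close> is a unit, \<open>a2\<close> and \<open>y\<close> are
    associated; \<open>inv x\<close> corrects the cofactor \<open>w\<close>.\<close>
  have "u = a2 \<otimes> (inv x \<otimes> w)"
  proof -
    have "a2 \<otimes> (inv x \<otimes> w) = (x \<otimes> inv x) \<otimes> (y \<otimes> w)"
      using x(1) y(1) w(1) unit unfolding a2xy by (simp add: m_ac del: Units_r_inv Units_l_inv)
    then show ?thesis
      using unit w y(1) by simp
  qed
  then have "a2 divides u"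
    using unit w(1) by (intro dividesI[of "inv x \<otimes> w"]) auto
  then show ?thesis
    using a1 a2 u by (simp add: divides_mult_lI)
qed

lemma square_free_divides_pow:
  assumes "a \<in> square_free_elements H" "b \<in> carrier H" "a divides b [^] (n::nat)"
  shows "a divides b"
  using assms
\<comment> \<open>The hypothesis is needed for \<open>a2\<close> in place of \<open>a\<close>, hence
  \<open>a\<close> varies. Starting at exponent 0 makes the base trivial: \<open>a\<close> divides
  \<open>\<one>\<close>, which divides \<open>b\<close>.\<close>
proof (induction n arbitrary: a)
  case 0
  have "\<one> divides b"
    using 0(2) by (intro dividesI[of b]) auto
  then show ?case
    using 0 divides_trans unfolding square_free_elements_def by simp
next
  case (Suc n)
  have a: "a \<in> carrier H"
    using Suc.prems(1) unfolding square_free_elements_def by blast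
  have "a divides b \<otimes> b [^] n"
    using Suc.prems(2,3) by (simp add: m_comm)
  then obtain a1 a2 where a1: "a1 \<in> carrier H" "a1 divides b"
    and a2: "a2 \<in> carrier H" "a2 divides b [^] n" and aa: "a = a1 \<otimes> a2"
    using decomposition[OF a Suc.prems(2) nat_pow_closed[OF Suc.prems(2)]] by blast
  have "a2 divides a"
    using a1(1) a2(1) aa by (intro dividesI[of a1]) (auto simp: m_comm)
  then have "a2 \<in> square_free_elements H"
    using square_free_divisor Suc.prems(1) a2(1) by blast
  then have "a2 divides b"
    using Suc.IH Suc.prems(2) a2(2) by blast
  then show ?case
    using square_free_mult_divides Suc.prems(1,2) a1 a2(1) aa by blast
qed

lemma square_free_imp_radical:
  assumes "a \<in> square_free_elements H"
  shows "a \<in> radical_elements H"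
  using assms square_free_divides_pow[OF assms]
  unfolding radical_elements_def square_free_elements_def by blast

end

theorem proposition6p4:
  fixes H :: "('a, 'm) monoid_scheme"
  assumes "decomposition_monoid H"
  shows "radical_elements H = square_free_elements H"
proof -
  interpret decomposition_monoid H
    by (fact assms)
  show ?thesis
    using radical_imp_square_free square_free_imp_radical by blast
qed

end
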